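(* Let $f,g:[0,b]\to[0,b]$ be continuous unimodal Allee maps with fixed points $0<A_f<K_f$ and $0<A_g<K_g$, with maxima $M_f=f(B_f)$ and $M_g=g(B_g)$ attained at $B_f$ and $B_g$ respectively, and with $b=\max(M_f,M_g)$. Let $p\in(0,1)$, and let $\{X_n\}_{n=0}^\infty$ be the random dynamical system with $X_0=x_0\in[0,b]$ in which $X_{n+1}=f(X_n)$ with probability $p$ and $X_{n+1}=g(X_n)$ with probability $1-p$, the choices being independent over $n$. Let $A_f<A_g$, let $f$ be differentiable and $|f'(x)|<1$ for every $x\in(B_f,M_f)$. Assume that there exist functions $h_1,h_2,\ldots,h_m\in\{f,g\}$ for which $h_1\circ h_2\circ\cdots\circ h_m(K_f)<A_f$. Then $P(\lim_{n\to\infty}X_n=0)=1$ for every $x_0\in[0,b]$.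
   Context: A function $f:[0,b]\to[0,b]$ is called an Allee map if: it has exactly three fixed points, namely $0$, which is a stable fixed point, an unstable fixed point (threshold) $A_f>0$, and a fixed point $K_f>A_f$ (which may or may not be stable); $f(x)<x$ for all $x\in(0,A_f)\cup(K_f,b]$; and $f(x)>x$ for all $x\in(A_f,K_f)$. A continuous Allee map $f$ is unimodal if there exists $B_f\in(A_f,K_f)$ such that $f$ is strictly increasing on $(0,B_f)$ and strictly decreasing on $(B_f,b)$; $M_f=f(B_f)$ denotes its maximum. The notation $A_g,K_g,B_g,M_g$ is the analogous one for $g$. Formally, $X_{n+1}=H_n(X_n)$, where the $H_n$ are i.i.d. random functions with $P(H_n=f)=p$ and $P(H_n=g)=1-p$; $x_0$ is deterministic. *)

theory Defs
  imports "HOL-Probability.Probability"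
begin

text \<open>A self-map of \<open>[0, b]\<close> is represented by a function on all of \<open>real\<close> of which only the
  values on \<open>{0..b}\<close> are constrained.  Stability of a fixed point is Lyapunov stability relative
  to the phase space \<open>S\<close>; an unstable fixed point is one that is not Lyapunov stable.\<close>

definition stable_fixed_point :: "'a::metric_space set \<Rightarrow> ('a \<Rightarrow> 'a) \<Rightarrow> 'a \<Rightarrow> bool" where
  "stable_fixed_point S f x \<longleftrightarrow> x \<in> S \<and> f x = x \<and>
     (\<forall>\<epsilon>>0. \<exists>\<delta>>0. \<forall>y\<in>S. dist y x < \<delta> \<longrightarrow> (\<forall>n. dist ((f ^^ n) y) x < \<epsilon>))"

definition unstable_fixed_point :: "'a::metric_space set \<Rightarrow> ('a \<Rightarrow> 'a) \<Rightarrow> 'a \<Rightarrow> bool" where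
  "unstable_fixed_point S f x \<longleftrightarrow> x \<in> S \<and> f x = x \<and> \<not> stable_fixed_point S f x"

definition allee_map :: "real \<Rightarrow> (real \<Rightarrow> real) \<Rightarrow> real \<Rightarrow> real \<Rightarrow> bool" where
  "allee_map b f A K \<longleftrightarrow>
     f \<in> {0..b} \<rightarrow> {0..b} \<and>
     0 < A \<and> A < K \<and>
     {x \<in> {0..b}. f x = x} = {0, A, K} \<and>
     stable_fixed_point {0..b} f 0 \<and>
     unstable_fixed_point {0..b} f A \<and>
     (\<forall>x \<in> {0<..<A} \<union> {K<..b}. f x < x) \<and>
     (\<forall>x \<in> {A<..<K}. x < f x)"

text \<open>\<open>B\<close> is the point at which the maximum \<open>f B\<close> is attained.\<close>

definition unimodal_allee_map :: "real \<Rightarrow> (real \<Rightarrow> real) \<Rightarrow> real \<Rightarrow> real \<Rightarrow> real \<Rightarrow> bool" where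
  "unimodal_allee_map b f A B K \<longleftrightarrow>
     allee_map b f A K \<and> continuous_on {0..b} f \<and>
     B \<in> {A<..<K} \<and>
     strict_mono_on {0<..<B} f \<and> strict_antimono_on {B<..<b} f"

primrec random_orbit :: "(nat \<Rightarrow> 'w \<Rightarrow> 'a \<Rightarrow> 'a) \<Rightarrow> 'a \<Rightarrow> nat \<Rightarrow> 'w \<Rightarrow> 'a" where
  "random_orbit H x\<^sub>0 0 \<omega> = x\<^sub>0"
| "random_orbit H x\<^sub>0 (Suc n) \<omega> = H n \<omega> (random_orbit H x\<^sub>0 n \<omega>)"

end

theory Submission
  imports Defs
begin

text \<open>Below the smaller threshold both maps decrease, so every orbit that enters \<open>[0, A\<^sub>f)\<close> stays
  there and tends to \<open>0\<close>; it remains to see that this interval is entered almost surely.  The set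
  \<open>C\<close> of points that no word in \<open>f, g\<close> takes below \<open>A\<^sub>f\<close> is compact and mapped into itself by \<open>f\<close>,
  and it does not contain \<open>K\<^sub>f\<close>.  On \<open>[B\<^sub>f, M\<^sub>f]\<close> the map \<open>f\<close> strictly reduces distances, so the
  point of \<open>C\<close> closest to \<open>K\<^sub>f\<close> there would be mapped closer still; in \<open>[A\<^sub>f, B\<^sub>f]\<close> the largest
  point of \<open>C\<close> would be mapped to a larger one.  Hence \<open>C\<close> is empty, and by compactness words of one
  common length suffice.  The probability of not having entered therefore decays geometrically.\<close>

section \<open>Law of the random orbit at a fixed time\<close>

text \<open>This is the backward equation: conditioning on the first choice. It concerns presence in
  \<open>S\<close> at time \<open>n\<close> itself; for \<open>S = - U\<close> with \<open>U\<close>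
  absorbing this becomes the probability of not having entered \<open>U\<close> by time
  \<open>n\<close>.\<close>

primrec hit_prob :: "real \<Rightarrow> ('a \<Rightarrow> 'a) \<Rightarrow> ('a \<Rightarrow> 'a) \<Rightarrow> 'a set \<Rightarrow> nat \<Rightarrow> 'a \<Rightarrow> real" where
  "hit_prob p f g S 0 x = indicator S x"
| "hit_prob p f g S (Suc n) x = p * hit_prob p f g S n (f x) + (1 - p) * hit_prob p f g S n (g x)"

locale random_choice = prob_space M for M :: "'w measure" +
  fixes f g :: "'a \<Rightarrow> 'a" and p :: real and H :: "nat \<Rightarrow> 'w \<Rightarrow> 'a \<Rightarrow> 'a"
  assumes indep: "indep_vars (\<lambda>_. count_space {f, g}) H UNIV"
    and prob_f: "\<And>n. prob {\<omega> \<in> space M. H n \<omega> = f} = p"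
    and prob_g: "\<And>n. prob {\<omega> \<in> space M. H n \<omega> = g} = 1 - p"
    and f_neq_g: "f \<noteq> g"
begin

lemma H_measurable: "H n \<in> measurable M (count_space {f, g})"
  using indep by (simp add: indep_vars_def)

lemma H_cases: "\<omega> \<in> space M \<Longrightarrow> H n \<omega> = f \<or> H n \<omega> = g"
  using measurable_space[OF H_measurable] by fastforce

lemma H_eq_event: "h \<in> {f, g} \<Longrightarrow> {\<omega> \<in> space M. H n \<omega> = h} \<in> events"
  using measurable_sets[OF H_measurable, of "{h}" n]
  by (simp add: vimage_def Int_def conj_commute)

text \<open>Only the first \<open>n\<close> entries of \<open>w\<close> matter. With a full sequence
  instead of a list, one more choice is prescribed by the update \<open>w(n := h)\<close>.\<close>

definition cylinder :: "(nat \<Rightarrow> 'a \<Rightarrow> 'a) \<Rightarrow> nat \<Rightarrow> 'w set" where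
  "cylinder w n = {\<omega> \<in> space M. \<forall>i<n. H i \<omega> = w i}"

lemma cylinder_Suc: "cylinder w (Suc n) = cylinder w n \<inter> {\<omega> \<in> space M. H n \<omega> = w n}"
  by (auto simp: cylinder_def less_Suc_eq)

lemma cylinder_event: "range w \<subseteq> {f, g} \<Longrightarrow> cylinder w n \<in> events"
proof (induction n)
  case (Suc n)
  then show ?case unfolding cylinder_Suc by (intro sets.Int H_eq_event) auto
qed (simp add: cylinder_def)

lemma prob_cylinder:
  assumes w: "range w \<subseteq> {f, g}"
  shows "prob (cylinder w n) = (\<Prod>i<n. prob {\<omega> \<in> space M. H i \<omega> = w i})"
proof (cases "n = 0")
  case False
  have "prob (\<Inter>i\<in>{..<n}. H i -` {w i} \<inter> space M) = (\<Prod>i\<in>{..<n}. prob (H i -` {w i} \<inter> space M))"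
    using w False by (intro indep_varsD[OF indep]) auto
  moreover have "(\<Inter>i\<in>{..<n}. H i -` {w i} \<inter> space M) = cylinder w n"
    using False by (auto simp: cylinder_def)
  ultimately show ?thesis by (simp add: vimage_def Int_def conj_commute)
qed (simp add: cylinder_def prob_space)

lemma random_orbit_cylinder:
  "\<omega> \<in> cylinder w n \<Longrightarrow> random_orbit H x n \<omega> = random_orbit (\<lambda>i _. w i) x n \<omega>"
  by (induction n) (auto simp: cylinder_def)

text \<open>With deterministic choices the sample point is a dummy argument, so it may differ on the
  two sides.\<close>

lemma random_orbit_const_cong:
  "(\<And>i. i < n \<Longrightarrow> w i = v i) \<Longrightarrow>
    random_orbit (\<lambda>i _. w i) x n \<omega> = random_orbit (\<lambda>i _. v i) x n \<omega>'"
  by (induction n) auto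

text \<open>A Markov property: once the first \<open>n\<close> choices are fixed, the remaining
  \<open>k\<close> steps have the law of a fresh orbit from the point reached. Each induction step
  splits the cylinder by the choice at time \<open>n\<close>, matching the recursion of
  \<open>hit_prob\<close>; hence \<open>w\<close> and \<open>n\<close> must vary.\<close>

lemma prob_cylinder_orbit:
  assumes "range w \<subseteq> {f, g}"
  shows "{\<omega> \<in> cylinder w n. random_orbit H x (n + k) \<omega> \<in> S} \<in> events \<and>
    prob {\<omega> \<in> cylinder w n. random_orbit H x (n + k) \<omega> \<in> S} =
    prob (cylinder w n) * hit_prob p f g S k (random_orbit (\<lambda>i _. w i) x n \<omega>\<^sub>0)"
  using assms
proof (induction k arbitrary: w n)
  case 0
  let ?y = "random_orbit (\<lambda>i _. w i) x n \<omega>\<^sub>0"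
  have "random_orbit H x n \<omega> = ?y" if "\<omega> \<in> cylinder w n" for \<omega>
    unfolding random_orbit_cylinder[OF that] by (rule random_orbit_const_cong) simp
  then have "{\<omega> \<in> cylinder w n. random_orbit H x (n + 0) \<omega> \<in> S} = (if ?y \<in> S then cylinder w n else {})"
    by auto
  then show ?case using cylinder_event[OF 0] by simp
next
  case (Suc k)
  define E where "E h = {\<omega> \<in> cylinder (w(n := h)) (Suc n). random_orbit H x (Suc n + k) \<omega> \<in> S}" for h
  let ?y = "random_orbit (\<lambda>i _. w i) x n \<omega>\<^sub>0"
  have cyl: "cylinder (w(n := h)) (Suc n) = cylinder w n \<inter> {\<omega> \<in> space M. H n \<omega> = h}" for h
    by (auto simp: cylinder_def less_Suc_eq)
  have "{\<omega> \<in> cylinder w n. random_orbit H x (n + Suc k) \<omega> \<in> S} = E f \<union> E g"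
    using H_cases by (auto simp: E_def cyl) (auto simp: cylinder_def)
  moreover have "E f \<inter> E g = {}" using f_neq_g by (auto simp: E_def cyl)
  moreover have "E h \<in> events \<and>
      prob (E h) = prob (cylinder w n) * prob {\<omega> \<in> space M. H n \<omega> = h} * hit_prob p f g S k (h ?y)"
    if "h \<in> {f, g}" for h
  proof -
    have r: "range (w(n := h)) \<subseteq> {f, g}" using Suc.prems that by auto
    have "random_orbit (\<lambda>i _. (w(n := h)) i) x (Suc n) \<omega>\<^sub>0 = h ?y"
      using random_orbit_const_cong[of n "w(n := h)" w x \<omega>\<^sub>0 \<omega>\<^sub>0] by simp
    moreover have "prob (cylinder (w(n := h)) (Suc n)) =
        prob (cylinder w n) * prob {\<omega> \<in> space M. H n \<omega> = h}"
      unfolding prob_cylinder[OF r] prob_cylinder[OF Suc.prems] by simp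
    ultimately show ?thesis using Suc.IH[OF r, of "Suc n"] unfolding E_def by (metis mult.assoc)
  qed
  ultimately show ?case
    using finite_measure_Union[of "E f" "E g"] sets.Un[of "E f" M "E g"] prob_f prob_g
    by (simp add: algebra_simps)
qed

lemma random_orbit_event: "{\<omega> \<in> space M. random_orbit H x n \<omega> \<in> S} \<in> events"
  and prob_random_orbit: "prob {\<omega> \<in> space M. random_orbit H x n \<omega> \<in> S} = hit_prob p f g S n x"
  \<comment> \<open>The cylinder of length 0 is the whole space, whatever the sequence.\<close>
  using prob_cylinder_orbit[of "\<lambda>_. f" 0 x n S] by (auto simp: cylinder_def prob_space)

end

section \<open>Points from which some word leads into a given set\<close>

text \<open>The map applied first is split off, as in \<open>hit_prob\<close>, so that one induction
  can compare the two. Staying inside \<open>D\<close> at each stage makes these sets relatively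
  open although the maps are continuous only on \<open>D\<close>.\<close>

primrec reach :: "'a set \<Rightarrow> ('a \<Rightarrow> 'a) \<Rightarrow> ('a \<Rightarrow> 'a) \<Rightarrow> 'a set \<Rightarrow> nat \<Rightarrow> 'a set" where
  "reach D f g U 0 = D \<inter> U"
| "reach D f g U (Suc n) = {x \<in> D. f x \<in> reach D f g U n \<or> g x \<in> reach D f g U n}"

lemma openin_reach:
  assumes "continuous_on D f" "continuous_on D g" "f \<in> D \<rightarrow> D" "g \<in> D \<rightarrow> D" "open U"
  shows "openin (top_of_set D) (reach D f g U n)"
proof (induction n)
  case 0
  then show ?case using assms(5) by (auto simp: openin_open)
next
  case (Suc n)
  have "reach D f g U (Suc n) = (D \<inter> f -` reach D f g U n) \<union> (D \<inter> g -` reach D f g U n)"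
    by auto
  then show ?case
    using continuous_openin_preimage[OF assms(1,3) Suc] continuous_openin_preimage[OF assms(2,4) Suc]
    by auto
qed

text \<open>A word ending in \<open>U\<close> can be prolonged by one more application of
  \<open>f\<close>, which does not leave \<open>D \<inter> U\<close>.\<close>

lemma reach_mono:
  assumes "\<And>x. x \<in> D \<inter> U \<Longrightarrow> f x \<in> D \<inter> U" and "m \<le> n"
  shows "reach D f g U m \<subseteq> reach D f g U n"
proof -
  have "reach D f g U k \<subseteq> reach D f g U (Suc k)" for k
    by (induction k) (use assms(1) in auto)
  then show ?thesis using assms(2) by (rule lift_Suc_mono_le)
qed

lemma reach_word:
  assumes "f \<in> D \<rightarrow> D" "g \<in> D \<rightarrow> D" "set hs \<subseteq> {f, g}" "x \<in> D" "foldr (\<circ>) hs id x \<in> U"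
  shows "x \<in> reach D f g U (length hs)"
  using assms(3-)
\<comment> \<open>In a composition the last letter acts first, and \<open>reach\<close> splits off
  the map acting first; hence the induction from the end of the list.\<close>
proof (induction hs arbitrary: x rule: rev_induct)
  case (snoc h hs)
  have "foldr (\<circ>) (hs @ [h]) id = foldr (\<circ>) hs id \<circ> h"
    by (induction hs) (auto simp: comp_assoc)
  moreover have "h x \<in> D" using snoc.prems assms(1,2) by auto
  moreover have "foldr (\<circ>) hs id (h x) \<in> U" using snoc.prems(3) calculation(1) by (metis comp_apply)
  ultimately have "h x \<in> reach D f g U (length hs)" 
    using snoc.IH[of "h x"] snoc.prems(1) by (metis le_sup_iff set_append)
  then show ?case using snoc.prems by auto
qed auto

text \<open>The relatively open sets \<open>reach D f g U n\<close> increase with \<open>n\<close>,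
  so the largest index of a finite subcover serves for all points.\<close>

lemma compact_reach_uniform:
  assumes "compact D" "continuous_on D f" "continuous_on D g" "f \<in> D \<rightarrow> D" "g \<in> D \<rightarrow> D" "open U"
    and "\<And>x. x \<in> D \<inter> U \<Longrightarrow> f x \<in> D \<inter> U"
    and "D \<subseteq> (\<Union>n. reach D f g U n)"
  obtains N where "D \<subseteq> reach D f g U N"
proof -
  have "\<forall>n. \<exists>T. open T \<and> reach D f g U n = D \<inter> T"
    using openin_reach[OF assms(2-6)] by (simp add: openin_open)
  then obtain T where T: "\<And>n. open (T n)" "\<And>n. reach D f g U n = D \<inter> T n" by metis
  obtain F where F: "finite F" "D \<subseteq> (\<Union>n\<in>F. T n)"
    using compactE_image[OF assms(1), of UNIV T] T assms(8) by auto
  \<comment> \<open>Inserting 0 keeps the maximum meaningful if \<open>F\<close> is empty.\<close>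
  have "D \<subseteq> reach D f g U (Max (insert 0 F))"
  proof
    fix x assume "x \<in> D"
    then obtain n where "n \<in> F" "x \<in> reach D f g U n" using F T by auto
    then show "x \<in> reach D f g U (Max (insert 0 F))"
      using reach_mono[of D U f n "Max (insert 0 F)" g] assms(7) F(1) by auto
  qed
  then show ?thesis using that by blast
qed

section \<open>Geometric decay of the probability of not being absorbed\<close>

context
  fixes p :: real and f g :: "'a \<Rightarrow> 'a" and D U :: "'a set"
  assumes p: "0 < p" "p < 1"
    and D: "f \<in> D \<rightarrow> D" "g \<in> D \<rightarrow> D"
    and U: "\<And>x. x \<in> D \<inter> U \<Longrightarrow> f x \<in> U" "\<And>x. x \<in> D \<inter> U \<Longrightarrow> g x \<in> U"
begin

lemma hit_prob_bounds: "0 \<le> hit_prob p f g S n x" "hit_prob p f g S n x \<le> 1"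
proof -
  have "0 \<le> hit_prob p f g S n x \<and> hit_prob p f g S n x \<le> 1"
  proof (induction n arbitrary: x)
    case (Suc n)
    have "p * hit_prob p f g S n (f x) + (1 - p) * hit_prob p f g S n (g x) \<le> p * 1 + (1 - p) * 1"
      using p Suc by (intro add_mono mult_left_mono) auto
    then show ?case using p Suc by simp
  qed (simp add: indicator_def)
  then show "0 \<le> hit_prob p f g S n x" "hit_prob p f g S n x \<le> 1" by auto
qed

lemma hit_prob_absorbed: "x \<in> D \<inter> U \<Longrightarrow> hit_prob p f g (- U) n x = 0"
proof (induction n arbitrary: x)
  case (Suc n)
  then have "f x \<in> D \<inter> U" "g x \<in> D \<inter> U" using D U by auto
  then show ?case using Suc.IH by simp
qed auto

text \<open>Any particular word of length \<open>n\<close> is chosen with probability at least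
  \<open>min p (1 - p) ^ n\<close>. Along a favourable word the orbit ends in \<open>U\<close>; off
  it the trivial bound 1 suffices.\<close>

lemma hit_prob_reach:
  "x \<in> reach D f g U n \<Longrightarrow> hit_prob p f g (- U) n x \<le> 1 - (min p (1 - p)) ^ n"
proof (induction n arbitrary: x)
  case (Suc n)
  define q where "q = min p (1 - p)"
  have q: "0 \<le> q ^ n" "q \<le> p" "q \<le> 1 - p" using p by (auto simp: q_def)
  have m: "q * q ^ n \<le> p * q ^ n" "q * q ^ n \<le> (1 - p) * q ^ n"
    using q by (auto intro: mult_right_mono)
  from Suc.prems consider "f x \<in> reach D f g U n" | "g x \<in> reach D f g U n" by auto
  then show ?case
  proof cases
    case 1
    have "p * hit_prob p f g (- U) n (f x) + (1 - p) * hit_prob p f g (- U) n (g x)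
        \<le> p * (1 - q ^ n) + (1 - p) * 1"
      using p Suc.IH[OF 1] hit_prob_bounds by (intro add_mono mult_left_mono) (auto simp: q_def)
    then show ?thesis using m by (simp add: q_def[symmetric] algebra_simps)
  next
    case 2
    have "p * hit_prob p f g (- U) n (f x) + (1 - p) * hit_prob p f g (- U) n (g x)
        \<le> p * 1 + (1 - p) * (1 - q ^ n)"
      using p Suc.IH[OF 2] hit_prob_bounds by (intro add_mono mult_left_mono) (auto simp: q_def)
    then show ?thesis using m by (simp add: q_def[symmetric] algebra_simps)
  qed
qed auto

lemma hit_prob_geometric:
  assumes "D \<subseteq> reach D f g U N" "x \<in> D"
  shows "hit_prob p f g (- U) (k * N) x \<le> (1 - (min p (1 - p)) ^ N) ^ k"
proof -
  define c where "c = 1 - (min p (1 - p)) ^ N"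
  have "min p (1 - p) ^ N \<le> 1" using p by (intro power_le_one) auto
  then have c: "0 \<le> c" by (simp add: c_def)
  \<comment> \<open>Peeling off the first \<open>n\<close> choices leaves a block of
    \<open>N\<close> steps from the point reached. If that point is in \<open>U\<close>, both sides
    vanish by absorption; otherwise the block succeeds with probability at least
    \<open>1 - c\<close>.\<close>
  have step: "hit_prob p f g (- U) (n + N) y \<le> c * hit_prob p f g (- U) n y" if "y \<in> D" for n y
    using that
  proof (induction n arbitrary: y)
    case 0
    then show ?case
      using hit_prob_absorbed[of y N] hit_prob_reach[of y N] assms(1)
      by (cases "y \<in> U") (auto simp: c_def)
  next
    case (Suc n)
    then have y: "f y \<in> D" "g y \<in> D" using D by auto
    have "p * hit_prob p f g (- U) (n + N) (f y) + (1 - p) * hit_prob p f g (- U) (n + N) (g y)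
        \<le> p * (c * hit_prob p f g (- U) n (f y)) + (1 - p) * (c * hit_prob p f g (- U) n (g y))"
      using p Suc.IH[OF y(1)] Suc.IH[OF y(2)] by (intro add_mono mult_left_mono) auto
    then show ?case by (simp add: algebra_simps)
  qed
  have "hit_prob p f g (- U) (k * N) x \<le> c ^ k"
  proof (induction k)
    case (Suc k)
    have "hit_prob p f g (- U) (k * N + N) x \<le> c * hit_prob p f g (- U) (k * N) x"
      using step assms(2) by blast
    also have "\<dots> \<le> c * c ^ k" using Suc c by (intro mult_left_mono)
    finally show ?case by (simp add: add.commute)
  qed (simp add: indicator_def)
  then show ?thesis by (simp add: c_def)
qed

end

section \<open>Allee maps and compact sets invariant under them\<close>

lemma allee_map_zero: "allee_map b f A K \<Longrightarrow> f 0 = 0"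
  unfolding allee_map_def by blast

lemma allee_map_fixed: "allee_map b f A K \<Longrightarrow> A \<in> {0..b} \<and> K \<in> {0..b} \<and> f K = K"
  unfolding allee_map_def by blast

lemma allee_map_below:
  assumes "allee_map b f A K" "0 \<le> x" "x < A"
  shows "0 \<le> f x \<and> f x \<le> x"
proof -
  have "x \<in> {0..b}" "f \<in> {0..b} \<rightarrow> {0..b}"
    using assms allee_map_fixed[OF assms(1)] by (auto simp: allee_map_def)
  then have "0 \<le> f x" by auto
  moreover have "f x < x" if "x \<noteq> 0" using assms that by (simp add: allee_map_def)
  ultimately show ?thesis using allee_map_zero[OF assms(1)] by (cases "x = 0") auto
qed

text \<open>Monotonicity is given only on open intervals. Continuity is used twice: letting
  \<open>z\<close> tend to \<open>B\<close> compares interior values with \<open>f B\<close>, and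
  passing to closures then covers the endpoints.\<close>

lemma unimodal_allee_map_le_max:
  assumes u: "unimodal_allee_map b f A B K" and x: "x \<in> {0..b}"
  shows "f x \<le> f B"
proof -
  have a: "allee_map b f A K" and cont: "continuous_on {0..b} f" and B: "A < B" "B < K"
    and inc: "strict_mono_on {0<..<B} f" and dec: "strict_antimono_on {B<..<b} f"
    using u by (auto simp: unimodal_allee_map_def)
  have Bb: "0 < B" "B < b" using B a allee_map_fixed[OF a] by (auto simp: allee_map_def)
  have l: "f y \<le> f B" if y: "y \<in> {0<..<B}" for y
  proof (rule continuous_ge_on_closure[of "{y<..<B}" f B "f y"])
    show "continuous_on (closure {y<..<B}) f"
      using y Bb by (auto intro: continuous_on_subset[OF cont])
    show "B \<in> closure {y<..<B}" using y by auto
    show "f y \<le> f z" if "z \<in> {y<..<B}" for z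
      using strict_mono_onD[OF inc, of y z] y that by auto
  qed
  have r: "f y \<le> f B" if y: "y \<in> {B<..<b}" for y
  proof (rule continuous_ge_on_closure[of "{B<..<y}" f B "f y"])
    show "continuous_on (closure {B<..<y}) f"
      using y Bb by (auto intro: continuous_on_subset[OF cont])
    show "B \<in> closure {B<..<y}" using y by auto
    show "f y \<le> f z" if "z \<in> {B<..<y}" for z
      using monotone_onD[OF dec, of z y] y that by auto
  qed
  show ?thesis
  proof (cases "x \<le> B")
    case True
    show ?thesis
      by (rule continuous_le_on_closure[of "{0<..<B}" f x "f B"])
        (use l Bb True x in \<open>auto intro: continuous_on_subset[OF cont]\<close>)
  next
    case False
    show ?thesis
      by (rule continuous_le_on_closure[of "{B<..<b}" f x "f B"])
        (use r Bb False x in \<open>auto intro: continuous_on_subset[OF cont]\<close>)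
  qed
qed

text \<open>Mean value theorem. The bound on the derivative is pointwise, so no contraction constant
  below 1 results, only a strict decrease of distances.\<close>

lemma contractive_of_deriv_less_one:
  fixes f :: "real \<Rightarrow> real"
  assumes "continuous_on {l..u} f"
    and "\<And>x. x \<in> {l<..<u} \<Longrightarrow> f differentiable (at x) \<and> \<bar>deriv f x\<bar> < 1"
    and "x \<in> {l..u}" "y \<in> {l..u}" "x \<noteq> y"
  shows "\<bar>f x - f y\<bar> < \<bar>x - y\<bar>"
proof -
  have less: "\<bar>f x - f y\<bar> < \<bar>x - y\<bar>" if xy: "x \<in> {l..u}" "y \<in> {l..u}" "x < y" for x y
  proof -
    have "continuous_on {x..y} f" using xy by (auto intro: continuous_on_subset[OF assms(1)])
    moreover have "f differentiable (at z)" if "x < z" "z < y" for z using assms(2) that xy by auto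
    ultimately obtain d z where z: "x < z" "z < y" "DERIV f z :> d" "f y - f x = (y - x) * d"
      using MVT[OF xy(3), of f] by blast
    have "\<bar>d\<bar> < 1" using assms(2)[of z] z xy DERIV_imp_deriv[OF z(3)] by auto
    then have "\<bar>y - x\<bar> * \<bar>d\<bar> < \<bar>y - x\<bar> * 1" using xy by (intro mult_strict_left_mono) auto
    then have "\<bar>f y - f x\<bar> < \<bar>y - x\<bar>" unfolding z(4) by (simp add: abs_mult)
    then show ?thesis by (simp add: abs_minus_commute)
  qed
  show ?thesis using less[of x y] less[of y x] assms(3-5) by (cases "x < y") (auto simp: abs_minus_commute)
qed

text \<open>In the absence of a uniform contraction constant, extremal points of \<open>C\<close>
  replace iteration. The interval must exclude \<open>A\<close>, since \<open>{A}\<close> is itself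
  compact and invariant.\<close>

lemma invariant_compact_contains_fixed_point:
  assumes u: "unimodal_allee_map b f A B K"
    and der: "\<And>x. x \<in> {B<..<f B} \<Longrightarrow> f differentiable (at x) \<and> \<bar>deriv f x\<bar> < 1"
    and C: "compact C" "C \<subseteq> {A<..b}" "f ` C \<subseteq> C" "C \<noteq> {}"
  shows "K \<in> C"
proof (rule ccontr)
  assume K: "K \<notin> C"
  have a: "allee_map b f A K" and cont: "continuous_on {0..b} f" and B: "A < B" "B < K"
    using u by (auto simp: unimodal_allee_map_def)
  have le: "f x \<le> f B" if "x \<in> {0..b}" for x using unimodal_allee_map_le_max[OF u that] .
  have pos: "0 < A" and self: "f \<in> {0..b} \<rightarrow> {0..b}" and up: "\<And>x. A < x \<Longrightarrow> x < K \<Longrightarrow> x < f x"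
    using a by (auto simp: allee_map_def)
  have Kb: "K \<in> {0..b}" "f K = K" using allee_map_fixed[OF a] by auto
  have BM: "B < f B" using up B by auto
  have Mb: "f B \<le> b" using self B pos Kb by auto
  have K_le: "K \<le> f B" using le Kb by metis
  have contr: "\<bar>f x - f y\<bar> < \<bar>x - y\<bar>" if "x \<in> {B..f B}" "y \<in> {B..f B}" "x \<noteq> y" for x y
    by (rule contractive_of_deriv_less_one[OF _ der that])
      (use B pos Mb in \<open>auto intro: continuous_on_subset[OF cont]\<close>)
  have right: "C \<inter> {B..f B} = {}"
  proof (rule ccontr)
    assume ne: "C \<inter> {B..f B} \<noteq> {}"
    have "compact (C \<inter> {B..f B})" using C(1) by (intro compact_Int) auto
    moreover have "continuous_on (C \<inter> {B..f B}) (\<lambda>z. \<bar>z - K\<bar>)" by (intro continuous_intros)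
    ultimately obtain y where y: "y \<in> C \<inter> {B..f B}"
      and least: "\<And>z. z \<in> C \<inter> {B..f B} \<Longrightarrow> \<bar>y - K\<bar> \<le> \<bar>z - K\<bar>"
      using continuous_attains_inf[OF _ ne] by blast
    have "f y \<in> C" "y \<in> {0..b}" "y \<noteq> K" using y C K pos by force+
    \<comment> \<open>Strict decrease of distances also makes \<open>{B..f B}\<close> invariant:
      \<open>f B - f y < y - B \<le> f B - B\<close>.\<close>
    moreover have "B \<le> f y"
      using contr[of B y] y BM by (cases "y = B") auto
    ultimately have "\<bar>y - K\<bar> \<le> \<bar>f y - K\<bar>" using least le by auto
    moreover have "\<bar>f y - f K\<bar> < \<bar>y - K\<bar>"
      using contr[of y K] y B K_le \<open>y \<noteq> K\<close> by auto
    ultimately show False using Kb by simp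
  qed
  have left: "C \<inter> {A..B} = {}"
  proof (rule ccontr)
    assume ne: "C \<inter> {A..B} \<noteq> {}"
    have "compact (C \<inter> {A..B})" using C(1) by (intro compact_Int) auto
    then obtain y where y: "y \<in> C \<inter> {A..B}" and most: "\<And>z. z \<in> C \<inter> {A..B} \<Longrightarrow> z \<le> y"
      using compact_attains_sup[OF _ ne] by blast
    have "f y \<in> C" "y \<in> {0..b}" "A < y" using y C pos by force+
    moreover have "y < f y" using up \<open>A < y\<close> y B by auto
    \<comment> \<open>As \<open>f y\<close> is at most \<open>f B\<close> and \<open>C\<close>
      misses \<open>{B..f B}\<close>, it lies below \<open>B\<close>.\<close>
    ultimately have "f y \<in> C \<inter> {A..B}" using right le[of y] by force
    then show False using most \<open>y < f y\<close> by fastforce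
  qed
  \<comment> \<open>\<open>C\<close> might still have points above \<open>f B\<close>; one
    application of \<open>f\<close> brings them down to where \<open>C\<close> has been shown to be
    empty.\<close>
  obtain c where c: "c \<in> C" using C(4) by blast
  then have "f c \<in> C" "f c \<le> f B" using C(2,3) le[of c] pos by force+
  then have "A < f c" using C(2) by auto
  then show False using \<open>f c \<in> C\<close> \<open>f c \<le> f B\<close> left right by force
qed

section \<open>Convergence below the threshold\<close>

text \<open>Taking the maximum of both images avoids tracking which map is used infinitely often: in
  the limit \<open>L \<le> max (f L) (g L)\<close>, which fails for
  \<open>0 < L < A\<close>.\<close>

lemma tendsto_zero_of_decreasing_maps:
  fixes f g :: "real \<Rightarrow> real"
  assumes "continuous_on {0..<A} f" "continuous_on {0..<A} g"
    and "\<And>x. 0 < x \<Longrightarrow> x < A \<Longrightarrow> f x < x" "\<And>x. 0 < x \<Longrightarrow> x < A \<Longrightarrow> g x < x"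
    and X: "\<And>n. X (Suc n) = f (X n) \<or> X (Suc n) = g (X n)" "\<And>n. 0 \<le> X n" "decseq X" "X 0 < A"
  shows "X \<longlonglongrightarrow> 0"
proof -
  obtain L where L: "X \<longlonglongrightarrow> L" "\<And>n. L \<le> X n"
    using decseq_convergent[OF X(3), of 0] X(2) by metis
  have L0: "0 \<le> L" "L < A" using LIMSEQ_le_const[OF L(1)] X(2) L(2)[of 0] X(4) by auto
  have XA: "X n \<in> {0..<A}" for n using X(2)[of n] decseqD[OF X(3), of 0 n] X(4) by auto
  have "(\<lambda>n. f (X n)) \<longlonglongrightarrow> f L" "(\<lambda>n. g (X n)) \<longlonglongrightarrow> g L"
    using continuous_on_tendsto_compose[OF assms(1) L(1)]
      continuous_on_tendsto_compose[OF assms(2) L(1)] L0 XA by auto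
  then have "(\<lambda>n. max (f (X n)) (g (X n))) \<longlonglongrightarrow> max (f L) (g L)" by (rule tendsto_max)
  moreover have "X (Suc n) \<le> max (f (X n)) (g (X n))" for n using X(1)[of n] by auto
  ultimately have "L \<le> max (f L) (g L)"
    using LIMSEQ_le[OF LIMSEQ_Suc[OF L(1)]] by blast
  then have "L = 0" using assms(3,4)[of L] L0 by fastforce
  then show ?thesis using L(1) by simp
qed

section \<open>Almost sure extinction\<close>

theorem theorem3:
  fixes f g :: "real \<Rightarrow> real" and b p A\<^sub>f B\<^sub>f K\<^sub>f M\<^sub>f A\<^sub>g B\<^sub>g K\<^sub>g M\<^sub>g :: real
    and M :: "'w measure" and H :: "nat \<Rightarrow> 'w \<Rightarrow> real \<Rightarrow> real"
  assumes "unimodal_allee_map b f A\<^sub>f B\<^sub>f K\<^sub>f"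
    and "unimodal_allee_map b g A\<^sub>g B\<^sub>g K\<^sub>g"
    and "M\<^sub>f = f B\<^sub>f" and "M\<^sub>g = g B\<^sub>g" and "b = max M\<^sub>f M\<^sub>g"
    and "0 < p" and "p < 1"
    and "prob_space M"
    and "prob_space.indep_vars M (\<lambda>_. count_space {f, g}) H UNIV"
    and "\<And>n. measure M {\<omega> \<in> space M. H n \<omega> = f} = p"
    and "\<And>n. measure M {\<omega> \<in> space M. H n \<omega> = g} = 1 - p"
    and "A\<^sub>f < A\<^sub>g"
    and "\<And>x. x \<in> {B\<^sub>f<..<M\<^sub>f} \<Longrightarrow> f differentiable (at x) \<and> \<bar>deriv f x\<bar> < 1"
    and "\<exists>hs. hs \<noteq> [] \<and> set hs \<subseteq> {f, g} \<and> foldr (\<circ>) hs id K\<^sub>f < A\<^sub>f"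
  shows "\<forall>x\<^sub>0 \<in> {0..b}.
    measure M {\<omega> \<in> space M. (\<lambda>n. random_orbit H x\<^sub>0 n \<omega>) \<longlonglongrightarrow> 0} = 1"
proof
  fix x\<^sub>0 assume x\<^sub>0: "x\<^sub>0 \<in> {0..b}"
  define D where "D = {0..b}"
  define U where "U = {..<A\<^sub>f}"
  have af: "allee_map b f A\<^sub>f K\<^sub>f" and ag: "allee_map b g A\<^sub>g K\<^sub>g"
    and cont: "continuous_on D f" "continuous_on D g"
    using assms(1,2) by (auto simp: unimodal_allee_map_def D_def)
  have self: "f \<in> D \<rightarrow> D" "g \<in> D \<rightarrow> D" and pos: "0 < A\<^sub>f"
    using af ag by (auto simp: allee_map_def D_def)
  have Ab: "A\<^sub>f \<in> D" "A\<^sub>g \<in> D" "K\<^sub>f \<in> D"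
    using allee_map_fixed[OF af] allee_map_fixed[OF ag] by (auto simp: D_def)
  have below: "f x < x \<and> g x < x" if "0 < x" "x < A\<^sub>f" for x
    using af ag that assms(12) by (auto simp: allee_map_def)
  have dec: "0 \<le> f x \<and> f x \<le> x \<and> 0 \<le> g x \<and> g x \<le> x" if "0 \<le> x" "x < A\<^sub>f" for x
    using allee_map_below[OF af] allee_map_below[OF ag] that assms(12) by auto
  \<comment> \<open>Here \<open>A\<^sub>f < A\<^sub>g\<close> enters. The fixed point
    \<open>A\<^sub>f\<close> of \<open>f\<close> escapes downwards through \<open>g\<close>, which
    also shows that the two maps differ.\<close>
  have gA: "g A\<^sub>f < A\<^sub>f" using ag pos assms(12) by (auto simp: allee_map_def)
  have fA: "f A\<^sub>f = A\<^sub>f" using af by (auto simp: allee_map_def)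
  have absorb: "f x \<in> U" "g x \<in> U" if "x \<in> D \<inter> U" for x
    using dec[of x] that by (auto simp: D_def U_def)
  interpret random_choice M f g p H
    using assms(8-11) gA fA by (auto simp: random_choice_def random_choice_axioms_def)

  have cover: "D \<subseteq> (\<Union>n. reach D f g U n)"
  proof (rule ccontr)
    define C where "C = D - (\<Union>n. reach D f g U n)"
    assume "\<not> D \<subseteq> (\<Union>n. reach D f g U n)"
    then have "C \<noteq> {}" by (auto simp: C_def)
    have "openin (top_of_set D) (\<Union>n. reach D f g U n)"
      using openin_reach[OF cont self, of U] by (intro openin_Union) (auto simp: U_def)
    then have "closedin (top_of_set D) C"
      unfolding C_def by (intro closedin_diff) auto
    then have "compact C" by (rule closedin_compact[rotated]) (simp add: D_def)
    moreover have "C \<subseteq> {A\<^sub>f<..b}"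
    proof
      fix x assume x: "x \<in> C"
      \<comment> \<open>Length 0 gives that \<open>x\<close> is at least \<open>A\<^sub>f\<close>;
        length 1 excludes equality, by \<open>g\<close>.\<close>
      then have "x \<in> D" "x \<notin> reach D f g U 0" "x \<notin> reach D f g U (Suc 0)"
        unfolding C_def by blast+
      moreover have "g A\<^sub>f \<in> D" using self Ab by auto
      ultimately show "x \<in> {A\<^sub>f<..b}"
        using gA by (cases "x = A\<^sub>f") (auto simp: D_def U_def)
    qed
    moreover have "f ` C \<subseteq> C"
    proof clarify
      fix x assume x: "x \<in> C"
      \<comment> \<open>A successful word from \<open>f x\<close>, preceded by \<open>f\<close>,
        would be successful from \<open>x\<close>.\<close>
      then have "f x \<notin> reach D f g U n" for n
        using reach.simps(2)[of D f g U n] by (auto simp: C_def simp del: reach.simps)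
      then show "f x \<in> C" using x self by (auto simp: C_def)
    qed
    ultimately have "K\<^sub>f \<in> C"
      using invariant_compact_contains_fixed_point[OF assms(1)] assms(3,13) \<open>C \<noteq> {}\<close> by blast
    moreover obtain hs where "set hs \<subseteq> {f, g}" "foldr (\<circ>) hs id K\<^sub>f < A\<^sub>f" using assms(14) by blast
    then have "K\<^sub>f \<in> reach D f g U (length hs)"
      using reach_word[OF self] Ab by (simp add: U_def)
    ultimately show False by (auto simp: C_def)
  qed
  have "compact D" "open U" by (auto simp: D_def U_def)
  moreover have "f x \<in> D \<inter> U" if "x \<in> D \<inter> U" for x using absorb[OF that] self that by auto
  ultimately obtain N where N: "D \<subseteq> reach D f g U N"
    using compact_reach_uniform[OF _ cont self _ _ cover] by blast

  let ?X = "random_orbit H x\<^sub>0"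
  have X_D: "?X n \<omega> \<in> D" if "\<omega> \<in> space M" for n \<omega>
    using x\<^sub>0 self H_cases[OF that] by (induction n) (force simp: D_def)+
  have tends: "(\<lambda>n. ?X n \<omega>) \<longlonglongrightarrow> 0" if \<omega>: "\<omega> \<in> space M" and n: "?X n \<omega> \<in> U" for n \<omega>
  proof -
    define Y where "Y k = ?X (k + n) \<omega>" for k
    have Y: "Y (Suc k) = f (Y k) \<or> Y (Suc k) = g (Y k)" for k
      using H_cases[OF \<omega>, of "k + n"] by (auto simp: Y_def)
    have YU: "Y k \<in> D \<inter> U" for k
    proof (induction k)
      case (Suc k)
      then show ?case using Y[of k] absorb[of "Y k"] self by auto
    qed (use n X_D[OF \<omega>] in \<open>auto simp: Y_def\<close>)
    have "Y (Suc k) \<le> Y k" for k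
      using Y[of k] YU[of k] dec[of "Y k"] by (auto simp: D_def U_def)
    then have "decseq Y" by (rule decseq_SucI)
    moreover have "{0..<A\<^sub>f} \<subseteq> D" using Ab by (auto simp: D_def)
    ultimately have "Y \<longlonglongrightarrow> 0"
      using Y YU below cont
      by (intro tendsto_zero_of_decreasing_maps[of A\<^sub>f f g Y])
        (auto simp: D_def U_def intro: continuous_on_subset)
    then show ?thesis unfolding Y_def by (rule LIMSEQ_offset)
  qed
  define E where "E = {\<omega> \<in> space M. (\<lambda>n. ?X n \<omega>) \<longlonglongrightarrow> 0}"
  \<comment> \<open>Convergence to 0 forces entry into \<open>U\<close> because
    \<open>A\<^sub>f\<close> is positive, and \<open>tends\<close> is the converse. The limit event
    is thus a countable union of events at single times.\<close>
  have E: "E = (\<Union>n. {\<omega> \<in> space M. ?X n \<omega> \<in> U})"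
  proof
    show "E \<subseteq> (\<Union>n. {\<omega> \<in> space M. ?X n \<omega> \<in> U})"
    proof
      fix \<omega> assume \<omega>: "\<omega> \<in> E"
      then have "\<forall>\<^sub>F n in sequentially. ?X n \<omega> < A\<^sub>f"
        using pos by (intro order_tendstoD(2)[of _ 0]) (auto simp: E_def)
      then show "\<omega> \<in> (\<Union>n. {\<omega> \<in> space M. ?X n \<omega> \<in> U})"
        using \<omega> eventually_happens[of _ sequentially] by (fastforce simp: E_def U_def)
    qed
  qed (use tends in \<open>auto simp: E_def\<close>)
  have ev: "E \<in> events"
    unfolding E using random_orbit_event by (intro sets.countable_UN) auto
  define c where "c = 1 - (min p (1 - p)) ^ N"
  have bound: "1 - prob E \<le> c ^ k" for k
  proof -
    have "1 - prob E = prob (space M - E)" using prob_compl[OF ev] by simp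
    \<comment> \<open>An orbit outside \<open>E\<close> is never in \<open>U\<close>, in particular
      not at time \<open>k * N\<close>.\<close>
    also have "\<dots> \<le> prob {\<omega> \<in> space M. ?X (k * N) \<omega> \<in> - U}"
      using random_orbit_event by (intro finite_measure_mono) (auto simp: E)
    also have "\<dots> = hit_prob p f g (- U) (k * N) x\<^sub>0" by (rule prob_random_orbit)
    also have "\<dots> \<le> c ^ k"
      using hit_prob_geometric[OF assms(6,7) self absorb N] x\<^sub>0 by (simp add: c_def D_def)
    finally show ?thesis .
  qed
  have "0 < min p (1 - p) ^ N" "min p (1 - p) ^ N \<le> 1"
    using assms(6,7) by (auto intro: power_le_one)
  then have "0 \<le> c" "c < 1" by (auto simp: c_def)
  then have "(\<lambda>k. c ^ k) \<longlonglongrightarrow> 0" by (intro LIMSEQ_realpow_zero)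
  then have "1 - prob E \<le> 0" by (rule LIMSEQ_le_const) (use bound in blast)
  then show "measure M {\<omega> \<in> space M. (\<lambda>n. ?X n \<omega>) \<longlonglongrightarrow> 0} = 1"
    unfolding E_def by (intro antisym prob_le_1) simp
qed

end
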